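(* The number $\pi$ is irrational. *)

theory Defs
  imports Complex_Main
begin

end

theory Submission
  imports Defs "HOL-Computational_Algebra.Polynomial"
begin

text \<open>
  Niven's argument. If \<open>pi = a / b\<close>, put \<open>f = x\<^sup>n (a - b x)\<^sup>n / n!\<close> and let \<open>F\<close> be the alternating
  sum of the even derivatives of \<open>f\<close>, so that \<open>F + F'' = f\<close>. All derivatives of \<open>f\<close> at \<open>0\<close> are
  integers, and \<open>f\<close> is symmetric about \<open>pi / 2\<close>, hence \<open>F(0) + F(pi)\<close> is an integer. It is also
  the increment over \<open>[0, pi]\<close> of the function \<open>F' sin - F cos\<close>, whose derivative is \<open>f sin\<close>; by
  the mean value theorem it lies strictly between \<open>0\<close> and \<open>1\<close> for large \<open>n\<close>.
\<close>

text \<open>The cutoff at order \<open>2 * n\<close> makes the sum finite; for degree at most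
  \<open>2 * n\<close> all later derivatives vanish.\<close>

definition alt_even_derivs :: "nat \<Rightarrow> 'a::idom poly \<Rightarrow> 'a poly" where
  "alt_even_derivs n p = (\<Sum>k\<le>n. smult ((-1) ^ k) ((pderiv ^^ (2 * k)) p))"

text \<open>Telescoping: the second derivative of each term cancels the next term, so only the first
  term and the second derivative of the last survive.\<close>

lemma alt_even_derivs_plus_pderiv2:
  "alt_even_derivs n p + pderiv (pderiv (alt_even_derivs n p))
     = p + smult ((-1) ^ n) ((pderiv ^^ (2 * n + 2)) p)"
  unfolding alt_even_derivs_def
  by (induction n) (simp_all add: pderiv_add pderiv_diff pderiv_smult pderiv_minus algebra_simps)

lemma higher_pderiv_eq_0:
  fixes p :: "'a::{idom,semiring_char_0} poly"
  shows "degree p < k \<Longrightarrow> (pderiv ^^ k) p = 0"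
  by (rule poly_eqI) (simp add: coeff_higher_pderiv coeff_eq_0)

lemma alt_even_derivs_ode:
  fixes p :: "'a::{idom,semiring_char_0} poly"
  assumes "degree p \<le> 2 * n"
  shows "alt_even_derivs n p + pderiv (pderiv (alt_even_derivs n p)) = p"
  using assms higher_pderiv_eq_0[of p "2 * n + 2"] by (simp only: alt_even_derivs_plus_pderiv2) simp

lemma poly_higher_pderiv_0:
  fixes p :: "'a::{idom,semiring_char_0} poly"
  shows "poly ((pderiv ^^ k) p) 0 = fact k * coeff p k"
  by (simp add: poly_0_coeff_0 coeff_higher_pderiv pochhammer_fact)

lemma higher_pderiv_reflect:
  fixes p :: "'a::idom poly"
  shows "(pderiv ^^ k) (p \<circ>\<^sub>p [:c, -1:]) = smult ((-1) ^ k) ((pderiv ^^ k) p \<circ>\<^sub>p [:c, -1:])"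
  by (induction k) (simp_all add: pderiv_smult pderiv_pcompose pderiv_pCons)

lemma coeff_power_Ints:
  fixes p :: "'a::comm_ring_1 poly"
  assumes "\<And>i. coeff p i \<in> \<int>"
  shows "coeff (p ^ n) i \<in> \<int>"
  using assms
  by (induction n arbitrary: i) (auto simp: coeff_mult one_pCons coeff_pCons split: nat.split intro!: Ints_sum)

lemma coeff_power_eq_0:
  fixes p :: "'a::comm_ring_1 poly"
  assumes "coeff p 0 = 0" "i < n"
  shows "coeff (p ^ n) i = 0"
proof -
  obtain q where "p = pCons 0 q"
    using assms(1) by (cases p) auto
  then have "p ^ n = monom 1 n * q ^ n"
    by (simp add: monom_altdef flip: power_mult_distrib)
  then show ?thesis
    using assms(2) by (simp add: coeff_monom_mult)
qed

text \<open>The derivative of order \<open>k\<close> at 0 is \<open>fact k / fact n\<close> times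
  the coefficient of \<open>p ^ n\<close> at \<open>k\<close>. For \<open>k < n\<close> that
  coefficient vanishes, as x divides \<open>p\<close>; otherwise \<open>fact n\<close> divides
  \<open>fact k\<close>.\<close>

lemma alt_even_derivs_0_Ints:
  fixes p :: "real poly"
  assumes "\<And>i. coeff p i \<in> \<int>" "coeff p 0 = 0"
  shows "poly (alt_even_derivs m (smult (1 / fact n) (p ^ n))) 0 \<in> \<int>"
proof -
  have "fact k * (coeff (p ^ n) k / fact n) \<in> \<int>" for k
  proof (cases "k < n")
    case True
    then show ?thesis
      using assms(2) by (simp add: coeff_power_eq_0)
  next
    case False
    then obtain d :: nat where "fact k = fact n * d"
      using fact_dvd[of n k] by (auto elim: dvdE)
    then have "fact k = fact n * real d"
      by (metis of_nat_fact of_nat_mult)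
    then show ?thesis
      using coeff_power_Ints[OF assms(1)] by simp
  qed
  then show ?thesis
    unfolding alt_even_derivs_def poly_sum poly_smult poly_higher_pderiv_0
    by (intro Ints_sum Ints_mult[of "(-1) ^ _"] Ints_power) simp_all
qed

text \<open>Each differentiation of a reflected polynomial contributes a factor -1; in even order
  the signs cancel.\<close>

lemma alt_even_derivs_reflect:
  fixes p :: "real poly"
  assumes "p \<circ>\<^sub>p [:c, -1:] = p"
  shows "poly (alt_even_derivs n p) c = poly (alt_even_derivs n p) 0"
proof -
  have "poly ((pderiv ^^ (2 * k)) p) c = poly ((pderiv ^^ (2 * k)) p) 0" for k
    using arg_cong[OF higher_pderiv_reflect[of "2 * k" p c], of "\<lambda>q. poly q 0"] assms
    by (simp add: poly_pcompose)
  then show ?thesis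
    by (simp add: alt_even_derivs_def poly_sum)
qed

lemma alt_even_derivs_mvt:
  fixes p :: "real poly"
  assumes "degree p \<le> 2 * n"
  obtains z where "0 < z" "z < pi"
    "poly (alt_even_derivs n p) 0 + poly (alt_even_derivs n p) pi = pi * (poly p z * sin z)"
proof -
  define F where "F = alt_even_derivs n p"
  have F: "poly (pderiv (pderiv F)) x = poly p x - poly F x" for x
    using arg_cong[OF alt_even_derivs_ode[OF assms], of "\<lambda>q. poly q x"] by (simp add: F_def)
  have "((\<lambda>x. poly (pderiv F) x * sin x - poly F x * cos x) has_real_derivative poly p x * sin x) (at x)" for x
    by (auto intro!: derivative_eq_intros simp: F algebra_simps)
  \<comment> \<open>At both endpoints sin vanishes, while cos goes from 1 to -1; hence the sum of
    the two values of \<open>F\<close>.\<close>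
  from MVT2[OF pi_gt_zero, of "\<lambda>x. poly (pderiv F) x * sin x - poly F x * cos x", OF this]
  obtain z where "0 < z" "z < pi" "poly F pi + poly F 0 = pi * (poly p z * sin z)"
    by auto
  then show thesis
    using that by (simp add: F_def add.commute)
qed

theorem theorem2: "pi \<notin> \<rat>"
proof
  assume "pi \<in> \<rat>"
  then obtain a b :: int where b: "b > 0" and "pi = a / b"
    by (elim Rats_cases')
  then have a: "real_of_int a = b * pi"
    by (simp add: field_simps)
  \<comment> \<open>A crude bound for \<open>p\<close> on the interval: both factors of
    \<open>z * (pi - z)\<close> are at most \<open>pi\<close>.\<close>
  define c where "c = b * pi\<^sup>2"
  define p :: "real poly" where "p = [:0, a, - b:]"
  have p_Ints: "coeff p i \<in> \<int>" for i
    by (auto simp: p_def coeff_pCons split: nat.split)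
  have p_bounds: "0 < poly p z" "poly p z \<le> c" if "0 < z" "z < pi" for z
  proof -
    have eq: "poly p z = b * (z * (pi - z))"
      by (simp add: p_def a algebra_simps)
    show "0 < poly p z"
      using that b by (simp add: eq)
    have "z * (pi - z) \<le> pi * pi"
      using that by (intro mult_mono) auto
    then show "poly p z \<le> c"
      using b by (simp add: eq c_def power2_eq_square)
  qed
  \<comment> \<open>The terms of the exponential series at \<open>c\<close> tend to 0.\<close>
  have "(\<lambda>n. pi * (c ^ n / fact n)) \<longlonglongrightarrow> pi * 0"
    using summable_LIMSEQ_zero[OF summable_exp[of c]]
    by (intro tendsto_mult tendsto_const) (simp add: divide_inverse mult.commute)
  then have "\<forall>\<^sub>F n in sequentially. pi * (c ^ n / fact n) < 1"
    by (intro order_tendstoD) auto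
  then obtain n where n: "pi * (c ^ n / fact n) < 1"
    by (auto simp: eventually_sequentially)
  define f where "f = smult (1 / fact n) (p ^ n)"
  define F where "F = alt_even_derivs n f"
  have "degree f \<le> 2 * n"
    using degree_power_le[of p n] b by (simp add: f_def p_def)
  then obtain z where z: "0 < z" "z < pi" and F: "poly F 0 + poly F pi = pi * (poly f z * sin z)"
    unfolding F_def by (rule alt_even_derivs_mvt)
  have "p \<circ>\<^sub>p [:pi, -1:] = p"
    by (simp add: p_def pcompose_pCons a algebra_simps)
  \<comment> \<open>Real polynomials with equal values everywhere are equal, so evaluation
    suffices.\<close>
  moreover have "p ^ n \<circ>\<^sub>p q = (p \<circ>\<^sub>p q) ^ n" for q
    by (simp flip: poly_eq_poly_eq_iff add: poly_pcompose fun_eq_iff)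
  ultimately have "f \<circ>\<^sub>p [:pi, -1:] = f"
    by (simp add: f_def pcompose_smult)
  then have "poly F 0 + poly F pi = 2 * poly F 0"
    by (simp add: F_def alt_even_derivs_reflect)
  moreover have "poly F 0 \<in> \<int>"
    unfolding F_def f_def using p_Ints by (intro alt_even_derivs_0_Ints) (auto simp: p_def)
  ultimately have "poly F 0 + poly F pi \<in> \<int>"
    by simp
  moreover have "0 < poly F 0 + poly F pi"
    using z p_bounds[OF z] by (simp add: F f_def sin_gt_zero)
  moreover have "poly F 0 + poly F pi < 1"
  proof -
    have "poly f z * sin z \<le> c ^ n / fact n * 1"
      using z p_bounds[OF z] less_imp_le[OF sin_gt_zero[OF z]]
      by (intro mult_mono) (auto simp: f_def divide_right_mono power_mono)
    then have "pi * (poly f z * sin z) \<le> pi * (c ^ n / fact n)"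
      by (intro mult_left_mono) simp_all
    with n show ?thesis
      unfolding F by linarith
  qed
  ultimately show False
    by (auto elim!: Ints_cases)
qed

end
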